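(* For any two connected graphs $G$ and $H$, $md(G \square H) = md(G) + md(H)$.
   Context: The Cartesian product $G \square H$ has vertex set $V(G)\times V(H)$, with $(u,v)$ and $(u',v')$ adjacent if and only if either $uu' \in E(G)$ and $v=v'$, or $vv' \in E(H)$ and $u=u'$. An edge-coloring of a graph $G$ is a map $\Gamma: E(G) \to [k]$ (adjacent edges may receive the same color); $|\Gamma|$ is the number of colors used. An edge-cut is monochromatic if all of its edges have the same color. An edge-coloring of $G$ is a monochromatic disconnection coloring (MD-coloring) if any two distinct vertices $u,v$ of $G$ are separated by a monochromatic edge-cut (equivalently, for some color $i$, $u$ and $v$ lie in different components of the graph obtained from $G$ by deleting all edges of color $i$). For a connected graph $G$, $md(G)$ is the maximum number of colors in an MD-coloring of $G$. *)

theory Defs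
  imports Main
begin

record 'a ugraph =
  verts :: "'a set"
  edges :: "'a set set"

definition simple_graph :: "'a ugraph \<Rightarrow> bool" where
  "simple_graph G \<longleftrightarrow> finite (verts G) \<and>
     edges G \<subseteq> {{u, v} | u v. u \<in> verts G \<and> v \<in> verts G \<and> u \<noteq> v}"

definition adj :: "'a ugraph \<Rightarrow> 'a \<Rightarrow> 'a \<Rightarrow> bool" where
  "adj G u v \<longleftrightarrow> {u, v} \<in> edges G"

definition same_component :: "'a ugraph \<Rightarrow> 'a \<Rightarrow> 'a \<Rightarrow> bool" where
  "same_component G u v \<longleftrightarrow> u \<in> verts G \<and> v \<in> verts G \<and> (adj G)\<^sup>*\<^sup>* u v"

text \<open>The graph without vertices does not count as connected.\<close>

definition connected_graph :: "'a ugraph \<Rightarrow> bool" where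
  "connected_graph G \<longleftrightarrow> verts G \<noteq> {} \<and>
     (\<forall>u \<in> verts G. \<forall>v \<in> verts G. same_component G u v)"

definition cartesian_product :: "'a ugraph \<Rightarrow> 'b ugraph \<Rightarrow> ('a \<times> 'b) ugraph"
    (infixl \<open>\<box>\<close> 70) where
  "G \<box> H = \<lparr> verts = verts G \<times> verts H,
     edges = {{(u, v), (u', v')} | u v u' v'.
       u \<in> verts G \<and> u' \<in> verts G \<and> v \<in> verts H \<and> v' \<in> verts H \<and>
       ({u, u'} \<in> edges G \<and> v = v' \<or> {v, v'} \<in> edges H \<and> u = u')} \<rparr>"

definition delete_edges :: "'a ugraph \<Rightarrow> 'a set set \<Rightarrow> 'a ugraph" where
  "delete_edges G F = \<lparr> verts = verts G, edges = edges G - F \<rparr>"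

definition edge_cut :: "'a ugraph \<Rightarrow> 'a set set \<Rightarrow> bool" where
  "edge_cut G F \<longleftrightarrow> F \<subseteq> edges G \<and> \<not> connected_graph (delete_edges G F)"

definition separates :: "'a ugraph \<Rightarrow> 'a set set \<Rightarrow> 'a \<Rightarrow> 'a \<Rightarrow> bool" where
  "separates G F u v \<longleftrightarrow> \<not> same_component (delete_edges G F) u v"

text \<open>Colorings are total functions on sets of vertices; only their values on the edges
  of the graph are ever used.\<close>

definition edge_coloring :: "'a ugraph \<Rightarrow> nat \<Rightarrow> ('a set \<Rightarrow> nat) \<Rightarrow> bool" where
  "edge_coloring G k \<Gamma> \<longleftrightarrow> \<Gamma> ` edges G \<subseteq> {1..k}"

definition num_colors :: "'a ugraph \<Rightarrow> ('a set \<Rightarrow> nat) \<Rightarrow> nat" where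
  "num_colors G \<Gamma> = card (\<Gamma> ` edges G)"

definition monochromatic :: "('a set \<Rightarrow> nat) \<Rightarrow> 'a set set \<Rightarrow> bool" where
  "monochromatic \<Gamma> F \<longleftrightarrow> (\<exists>i. \<forall>e \<in> F. \<Gamma> e = i)"

definition MD_coloring :: "'a ugraph \<Rightarrow> nat \<Rightarrow> ('a set \<Rightarrow> nat) \<Rightarrow> bool" where
  "MD_coloring G k \<Gamma> \<longleftrightarrow> edge_coloring G k \<Gamma> \<and>
     (\<forall>u \<in> verts G. \<forall>v \<in> verts G. u \<noteq> v \<longrightarrow>
        (\<exists>F. edge_cut G F \<and> monochromatic \<Gamma> F \<and> separates G F u v))"

definition md :: "'a ugraph \<Rightarrow> nat" where
  "md G = Max {num_colors G \<Gamma> | \<Gamma> k. MD_coloring G k \<Gamma>}"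

lemma MD_coloring_iff_delete_color:
  "MD_coloring G k \<Gamma> \<longleftrightarrow> edge_coloring G k \<Gamma> \<and>
     (\<forall>u \<in> verts G. \<forall>v \<in> verts G. u \<noteq> v \<longrightarrow>
        (\<exists>i. \<not> same_component (delete_edges G {e \<in> edges G. \<Gamma> e = i}) u v))"
proof -
  have "(\<exists>F. edge_cut G F \<and> monochromatic \<Gamma> F \<and> separates G F u v) \<longleftrightarrow>
        (\<exists>i. \<not> same_component (delete_edges G {e \<in> edges G. \<Gamma> e = i}) u v)"
    if uv: "u \<in> verts G" "v \<in> verts G" for u v
  proof
    assume "\<exists>F. edge_cut G F \<and> monochromatic \<Gamma> F \<and> separates G F u v"
    then obtain F i where F: "F \<subseteq> edges G" "\<forall>e \<in> F. \<Gamma> e = i"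
      and sep: "\<not> same_component (delete_edges G F) u v"
      by (auto simp: edge_cut_def monochromatic_def separates_def)
    have "adj (delete_edges G {e \<in> edges G. \<Gamma> e = i}) \<le> adj (delete_edges G F)"
      using F by (auto simp: adj_def delete_edges_def)
    from rtranclp_mono[OF this] sep
    have "\<not> same_component (delete_edges G {e \<in> edges G. \<Gamma> e = i}) u v"
      by (auto simp: same_component_def delete_edges_def)
    then show "\<exists>i. \<not> same_component (delete_edges G {e \<in> edges G. \<Gamma> e = i}) u v" ..
  next
    assume "\<exists>i. \<not> same_component (delete_edges G {e \<in> edges G. \<Gamma> e = i}) u v"
    then obtain i where i: "\<not> same_component (delete_edges G {e \<in> edges G. \<Gamma> e = i}) u v" ..
    then have "\<not> connected_graph (delete_edges G {e \<in> edges G. \<Gamma> e = i})"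
      using uv by (auto simp: connected_graph_def delete_edges_def)
    then show "\<exists>F. edge_cut G F \<and> monochromatic \<Gamma> F \<and> separates G F u v"
      using i by (intro exI[of _ "{e \<in> edges G. \<Gamma> e = i}"])
        (auto simp: edge_cut_def monochromatic_def separates_def)
  qed
  then show ?thesis unfolding MD_coloring_def by blast
qed

text \<open>The maximum in the definition of \<^const>\<open>md\<close> is taken over a finite nonempty set.\<close>

lemma finite_edges:
  assumes "simple_graph G" shows "finite (edges G)"
proof (rule finite_subset)
  show "edges G \<subseteq> Pow (verts G)" using assms by (auto simp: simple_graph_def)
  show "finite (Pow (verts G))" using assms by (simp add: simple_graph_def)
qed

lemma finite_num_colors:
  assumes "simple_graph G"
  shows "finite {num_colors G \<Gamma> | \<Gamma> k. MD_coloring G k \<Gamma>}"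
proof (rule finite_subset)
  show "{num_colors G \<Gamma> | \<Gamma> k. MD_coloring G k \<Gamma>} \<subseteq> {..card (edges G)}"
    using finite_edges[OF assms] by (auto simp: num_colors_def card_image_le)
qed simp

lemma nonempty_num_colors: "{num_colors G \<Gamma> | \<Gamma> k. MD_coloring G k \<Gamma>} \<noteq> {}"
proof -
  have no_path: "\<not> same_component (delete_edges G (edges G)) u v" if "u \<noteq> v" for u v
    using that by (auto simp: same_component_def delete_edges_def adj_def elim: rtranclp.cases)
  then have "MD_coloring G 1 (\<lambda>_. 1)"
    unfolding MD_coloring_iff_delete_color
    by (auto simp: edge_coloring_def intro!: exI[of _ "Suc 0"])
  then show ?thesis by blast
qed

end

(* Give the two factors disjoint palettes: a color that separates u from u' in G still
   separates all lifts, since walks project to G. This yields md(G) + md(H) colors.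
   Conversely, in an MD-coloring of a 4-cycle opposite edges agree. Hence in G \<box> H all copies
   of an edge of one factor have the same color, so every color of the product occurs on one
   fixed copy of G or on one fixed copy of H, and an MD-coloring restricts to an MD-coloring
   of each copy. *)

theory Submission
  imports Defs
begin

section \<open>Walks that avoid a color\<close>

definition color_avoiding :: "'a ugraph \<Rightarrow> ('a set \<Rightarrow> nat) \<Rightarrow> nat \<Rightarrow> 'a \<Rightarrow> 'a \<Rightarrow> bool" where
  "color_avoiding G \<Gamma> i u v \<longleftrightarrow> {u, v} \<in> edges G \<and> \<Gamma> {u, v} \<noteq> i"

text \<open>Deleting the edges of color \<open>i\<close> leaves exactly
  \<open>color_avoiding G \<Gamma> i\<close> as adjacency relation. Separation thus becomes the
  absence of a walk, which can be transported along maps between graphs.\<close>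

lemma MD_coloring_iff_color_avoiding:
  "MD_coloring G k \<Gamma> \<longleftrightarrow> edge_coloring G k \<Gamma> \<and>
     (\<forall>u \<in> verts G. \<forall>v \<in> verts G. u \<noteq> v \<longrightarrow> (\<exists>i. \<not> (color_avoiding G \<Gamma> i)\<^sup>*\<^sup>* u v))"
proof -
  have "adj (delete_edges G {e \<in> edges G. \<Gamma> e = i}) = color_avoiding G \<Gamma> i" for i
    by (auto simp: fun_eq_iff adj_def delete_edges_def color_avoiding_def)
  then show ?thesis
    unfolding MD_coloring_iff_delete_color same_component_def by (auto simp: delete_edges_def)
qed

lemma MD_coloring_separating_color:
  assumes "MD_coloring G k \<Gamma>" "u \<in> verts G" "v \<in> verts G" "u \<noteq> v"
  obtains i where "\<not> (color_avoiding G \<Gamma> i)\<^sup>*\<^sup>* u v"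
  using assms unfolding MD_coloring_iff_color_avoiding by blast

text \<open>The closure of \<open>s\<close> in the premise lets a single step collapse to a point,
  as happens when a product edge is projected to the factor in which it does not move.\<close>

lemma rtranclp_map:
  assumes "r\<^sup>*\<^sup>* x y" and "\<And>x y. r x y \<Longrightarrow> s\<^sup>*\<^sup>* (f x) (f y)"
  shows "s\<^sup>*\<^sup>* (f x) (f y)"
  using assms(1) by induction (auto dest: assms(2) intro: rtranclp_trans)

lemma num_colors_le_md:
  assumes "simple_graph G" "MD_coloring G k \<Gamma>"
  shows "num_colors G \<Gamma> \<le> md G"
  unfolding md_def using assms by (intro Max_ge finite_num_colors) auto

lemma md_attained:
  assumes "simple_graph G"
  obtains \<Gamma> k where "MD_coloring G k \<Gamma>" "num_colors G \<Gamma> = md G"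
  using Max_in[OF finite_num_colors[OF assms] nonempty_num_colors] unfolding md_def by auto

section \<open>Edges of simple graphs and of Cartesian products\<close>

lemma simple_graph_edgeE:
  assumes "simple_graph G" "e \<in> edges G"
  obtains u v where "e = {u, v}" "u \<in> verts G" "v \<in> verts G" "u \<noteq> v"
  using assms unfolding simple_graph_def by blast

lemma simple_graph_edgeD:
  assumes "simple_graph G" "{u, v} \<in> edges G"
  shows "u \<in> verts G" "v \<in> verts G" "u \<noteq> v"
  using assms by (auto elim!: simple_graph_edgeE simp: doubleton_eq_iff)

lemma singleton_notin_edges: "simple_graph G \<Longrightarrow> {u} \<notin> edges G"
  using simple_graph_edgeD(3)[of G u u] by auto

lemma verts_cartesian_product [simp]: "verts (G \<box> H) = verts G \<times> verts H"
  by (simp add: cartesian_product_def)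

lemma doubleton_in_edges_cartesian_product:
  "{(u, v), (u', v')} \<in> edges (G \<box> H) \<longleftrightarrow>
     u \<in> verts G \<and> u' \<in> verts G \<and> v \<in> verts H \<and> v' \<in> verts H \<and>
     ({u, u'} \<in> edges G \<and> v = v' \<or> {v, v'} \<in> edges H \<and> u = u')"
  unfolding cartesian_product_def by (auto simp: doubleton_eq_iff insert_commute)

text \<open>Written as set products, the edges display the factor edge that they copy and the fixed
  coordinate, so colors can be compared copy by copy.\<close>

lemma edges_cartesian_product:
  assumes "simple_graph G" "simple_graph H"
  shows "edges (G \<box> H) =
    {e \<times> {v} | e v. e \<in> edges G \<and> v \<in> verts H} \<union> {{u} \<times> f | u f. u \<in> verts G \<and> f \<in> edges H}"
    (is "_ = ?A \<union> ?B")
proof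
  have "{(u, v), (u', v)} = {u, u'} \<times> {v}" "{(u, v), (u, v')} = {u} \<times> {v, v'}"
    for u u' :: 'a and v v' :: 'b by auto
  then show "edges (G \<box> H) \<subseteq> ?A \<union> ?B"
    unfolding cartesian_product_def by auto
  have "e \<times> {v} \<in> edges (G \<box> H)" if e: "e \<in> edges G" and v: "v \<in> verts H" for e v
    using assms(1) e
  proof (rule simple_graph_edgeE)
    fix u u' assume "e = {u, u'}" "u \<in> verts G" "u' \<in> verts G"
    then show ?thesis
      using e v doubleton_in_edges_cartesian_product[of u v u' v G H] by simp
  qed
  moreover have "{u} \<times> f \<in> edges (G \<box> H)" if u: "u \<in> verts G" and f: "f \<in> edges H" for u f
    using assms(2) f
  proof (rule simple_graph_edgeE)
    fix v v' assume "f = {v, v'}" "v \<in> verts H" "v' \<in> verts H"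
    then show ?thesis
      using u f doubleton_in_edges_cartesian_product[of u v u v' G H] by simp
  qed
  ultimately show "?A \<union> ?B \<subseteq> edges (G \<box> H)"
    by blast
qed

lemma simple_graph_cartesian_product:
  assumes "simple_graph G" "simple_graph H"
  shows "simple_graph (G \<box> H)"
  unfolding simple_graph_def
proof (intro conjI subsetI)
  show "finite (verts (G \<box> H))"
    using assms by (simp add: simple_graph_def)
  fix e assume "e \<in> edges (G \<box> H)"
  moreover from this obtain u v u' v' where e: "e = {(u, v), (u', v')}"
    unfolding cartesian_product_def by auto
  ultimately have edge: "{(u, v), (u', v')} \<in> edges (G \<box> H)"
    by simp
  from edge have "(u, v) \<noteq> (u', v')"
    using assms by (auto simp: doubleton_in_edges_cartesian_product singleton_notin_edges)
  then show "e \<in> {{x, y} | x y. x \<in> verts (G \<box> H) \<and> y \<in> verts (G \<box> H) \<and> x \<noteq> y}"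
    using edge unfolding e doubleton_in_edges_cartesian_product verts_cartesian_product by blast
qed

section \<open>Lower bound: combining colorings of the factors\<close>

lemma md_cartesian_product_ge:
  assumes G: "simple_graph G" "verts G \<noteq> {}" and H: "simple_graph H" "verts H \<noteq> {}"
  shows "md G + md H \<le> md (G \<box> H)"
proof -
  obtain \<Gamma>G k where MG: "MD_coloring G k \<Gamma>G" and nG: "num_colors G \<Gamma>G = md G"
    using md_attained[OF G(1)] .
  obtain \<Gamma>H l where MH: "MD_coloring H l \<Gamma>H" and nH: "num_colors H \<Gamma>H = md H"
    using md_attained[OF H(1)] .
  \<comment> \<open>Even colors serve \<open>G\<close> and odd ones serve \<open>H\<close>. The
    first projection tells the two kinds of edges apart: a copy of an edge of \<open>H\<close>
    projects to a singleton, which is not an edge of \<open>G\<close>.\<close>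
  define \<Gamma> where "\<Gamma> e = (if fst ` e \<in> edges G then 2 * \<Gamma>G (fst ` e) else 2 * \<Gamma>H (snd ` e) + 1)"
    for e :: "('a \<times> 'b) set"
  have \<Gamma>1: "\<Gamma> (e \<times> {v}) = 2 * \<Gamma>G e" if "e \<in> edges G" for e v
    using that by (simp add: \<Gamma>_def)
  have \<Gamma>2: "\<Gamma> ({u} \<times> f) = 2 * \<Gamma>H f + 1" if "f \<in> edges H" for u f
  proof -
    \<comment> \<open>For nonempty \<open>f\<close> the first projection of
      \<open>{u} \<times> f\<close> is \<open>{u}\<close>.\<close>
    have "f \<noteq> {}"
      using that H(1) by (auto elim: simple_graph_edgeE)
    then show ?thesis
      by (simp add: \<Gamma>_def singleton_notin_edges[OF G(1)])
  qed
  have img: "\<Gamma> ` edges (G \<box> H) = (\<lambda>n. 2 * n) ` \<Gamma>G ` edges G \<union> (\<lambda>n. 2 * n + 1) ` \<Gamma>H ` edges H"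
    (is "_ = ?A \<union> ?B")
  proof
    show "\<Gamma> ` edges (G \<box> H) \<subseteq> ?A \<union> ?B"
      by (auto simp: edges_cartesian_product[OF G(1) H(1)] \<Gamma>1 \<Gamma>2[simplified])
    \<comment> \<open>The base vertices provide one copy of each factor, on which all colors of that
      factor occur.\<close>
    obtain u0 v0 where "u0 \<in> verts G" "v0 \<in> verts H"
      using G H by blast
    then have "2 * \<Gamma>G e \<in> \<Gamma> ` edges (G \<box> H)" if "e \<in> edges G" for e
      using that \<Gamma>1[of e v0] unfolding edges_cartesian_product[OF G(1) H(1)]
      by (intro image_eqI[of _ _ "e \<times> {v0}"]) auto
    moreover have "2 * \<Gamma>H f + 1 \<in> \<Gamma> ` edges (G \<box> H)" if "f \<in> edges H" for f
      using that \<Gamma>2[of f u0] \<open>u0 \<in> verts G\<close> unfolding edges_cartesian_product[OF G(1) H(1)]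
      by (intro image_eqI[of _ _ "{u0} \<times> f"]) auto
    ultimately show "?A \<union> ?B \<subseteq> \<Gamma> ` edges (G \<box> H)"
      by auto
  qed
  have fin: "finite (\<Gamma>G ` edges G)" "finite (\<Gamma>H ` edges H)"
    using G H by (simp_all add: finite_edges)
  have "?A \<inter> ?B = {}"
    by (auto dest: arg_cong[of _ _ even])
  then have "num_colors (G \<box> H) \<Gamma> = card ?A + card ?B"
    unfolding num_colors_def img using fin by (intro card_Un_disjoint) auto
  also have "\<dots> = md G + md H"
    unfolding nG[symmetric] nH[symmetric] num_colors_def by (simp add: card_image inj_on_def)
  finally have num: "num_colors (G \<box> H) \<Gamma> = md G + md H" .
  \<comment> \<open>A step along \<open>H\<close> collapses under \<open>fst\<close>. A step along
    \<open>G\<close> has an even color different from \<open>2 * i\<close>, so its projection avoids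
    \<open>i\<close>.\<close>
  have proj1: "(color_avoiding G \<Gamma>G i)\<^sup>*\<^sup>* (fst x) (fst y)"
    if "(color_avoiding (G \<box> H) \<Gamma> (2 * i))\<^sup>*\<^sup>* x y" for i x y
    using that
  proof (rule rtranclp_map)
    fix x y assume step: "color_avoiding (G \<box> H) \<Gamma> (2 * i) x y"
    obtain u v u' v' where xy: "x = (u, v)" "y = (u', v')"
      by (metis surj_pair)
    have "u = u' \<or> color_avoiding G \<Gamma>G i u u'"
      using step unfolding xy color_avoiding_def doubleton_in_edges_cartesian_product
      by (auto simp: \<Gamma>_def)
    then show "(color_avoiding G \<Gamma>G i)\<^sup>*\<^sup>* (fst x) (fst y)"
      by (auto simp: xy)
  qed
  have proj2: "(color_avoiding H \<Gamma>H i)\<^sup>*\<^sup>* (snd x) (snd y)"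
    if "(color_avoiding (G \<box> H) \<Gamma> (2 * i + 1))\<^sup>*\<^sup>* x y" for i x y
    using that
  proof (rule rtranclp_map)
    fix x y assume step: "color_avoiding (G \<box> H) \<Gamma> (2 * i + 1) x y"
    obtain u v u' v' where xy: "x = (u, v)" "y = (u', v')"
      by (metis surj_pair)
    have "v = v' \<or> color_avoiding H \<Gamma>H i v v'"
      using step unfolding xy color_avoiding_def doubleton_in_edges_cartesian_product
      by (auto simp: \<Gamma>_def singleton_notin_edges[OF G(1)])
    then show "(color_avoiding H \<Gamma>H i)\<^sup>*\<^sup>* (snd x) (snd y)"
      by (auto simp: xy)
  qed
  \<comment> \<open>A crude common bound for even colors up to \<open>2 * k\<close> and odd ones up
    to \<open>2 * l + 1\<close>; the colors in use are counted by \<open>num\<close>.\<close>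
  have "edge_coloring (G \<box> H) (2 * k + 2 * l + 1) \<Gamma>"
    using MG MH unfolding edge_coloring_def img MD_coloring_def by fastforce
  moreover have "\<exists>i. \<not> (color_avoiding (G \<box> H) \<Gamma> i)\<^sup>*\<^sup>* x y"
    if xy: "x \<in> verts (G \<box> H)" "y \<in> verts (G \<box> H)" "x \<noteq> y" for x y
  proof (cases "fst x = fst y")
    case False
    then obtain i where "\<not> (color_avoiding G \<Gamma>G i)\<^sup>*\<^sup>* (fst x) (fst y)"
      by (rule MD_coloring_separating_color[OF MG, rotated 2])
        (use xy in \<open>simp_all add: mem_Times_iff\<close>)
    then show ?thesis
      using proj1 by blast
  next
    case True
    with xy have "snd x \<noteq> snd y"
      by (simp add: prod_eq_iff)
    then obtain i where "\<not> (color_avoiding H \<Gamma>H i)\<^sup>*\<^sup>* (snd x) (snd y)"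
      by (rule MD_coloring_separating_color[OF MH, rotated 2])
        (use xy in \<open>simp_all add: mem_Times_iff\<close>)
    then show ?thesis
      using proj2 by blast
  qed
  ultimately have "MD_coloring (G \<box> H) (2 * k + 2 * l + 1) \<Gamma>"
    unfolding MD_coloring_iff_color_avoiding by blast
  from num_colors_le_md[OF simple_graph_cartesian_product[OF G(1) H(1)] this]
  show ?thesis
    unfolding num .
qed

section \<open>Opposite edges of 4-cycles\<close>

text \<open>If \<open>{a, b}\<close> and \<open>{c, d}\<close> had different colors, the other two
  edges would carry these same two colors, one each. Then two opposite vertices are joined by two
  paths, each of a single color and the colors distinct, so no color separates them.\<close>

lemma MD_coloring_four_cycle:
  assumes M: "MD_coloring G k \<Gamma>"
    and E: "{a, b} \<in> edges G" "{b, c} \<in> edges G" "{c, d} \<in> edges G" "{d, a} \<in> edges G"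
    and V: "a \<in> verts G" "b \<in> verts G" "c \<in> verts G" "d \<in> verts G"
    and dist: "a \<noteq> b" "c \<noteq> d" "a \<noteq> c" "b \<noteq> d"
  shows "\<Gamma> {a, b} = \<Gamma> {c, d}"
proof (rule ccontr)
  assume ne: "\<Gamma> {a, b} \<noteq> \<Gamma> {c, d}"
  have R: "(color_avoiding G \<Gamma> i)\<^sup>*\<^sup>* x y" if "{x, y} \<in> edges G" "\<Gamma> {x, y} \<noteq> i" for i x y
    using that by (auto simp: color_avoiding_def)
  have R2: "(color_avoiding G \<Gamma> i)\<^sup>*\<^sup>* x z"
    if "{x, y} \<in> edges G" "\<Gamma> {x, y} \<noteq> i" "{y, z} \<in> edges G" "\<Gamma> {y, z} \<noteq> i" for i x y z
    using R[OF that(1,2)] R[OF that(3,4)] by (rule rtranclp_trans)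
  have comm: "{b, a} = {a, b}" "{c, b} = {b, c}" "{d, c} = {c, d}" "{a, d} = {d, a}"
    by auto
  \<comment> \<open>A color separating \<open>a\<close> from \<open>b\<close> must occur on the edge
    \<open>{a, b}\<close> and also on the path \<open>a\<close>, \<open>d\<close>, \<open>c\<close>,
    \<open>b\<close>.\<close>
  have ab: "\<Gamma> {b, c} = \<Gamma> {a, b} \<or> \<Gamma> {d, a} = \<Gamma> {a, b}"
  proof -
    obtain i where i: "\<not> (color_avoiding G \<Gamma> i)\<^sup>*\<^sup>* a b"
      using MD_coloring_separating_color[OF M V(1,2) dist(1)] .
    then have "\<Gamma> {a, b} = i"
      using R E by blast
    moreover have "\<Gamma> {d, a} = i \<or> \<Gamma> {c, d} = i \<or> \<Gamma> {b, c} = i"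
      using i R2[of a d i c] R[of c b i] E comm by (metis rtranclp_trans)
    ultimately show ?thesis
      using ne by auto
  qed
  have cd: "\<Gamma> {b, c} = \<Gamma> {c, d} \<or> \<Gamma> {d, a} = \<Gamma> {c, d}"
  proof -
    obtain i where i: "\<not> (color_avoiding G \<Gamma> i)\<^sup>*\<^sup>* c d"
      using MD_coloring_separating_color[OF M V(3,4) dist(2)] .
    then have "\<Gamma> {c, d} = i"
      using R E by blast
    moreover have "\<Gamma> {d, a} = i \<or> \<Gamma> {a, b} = i \<or> \<Gamma> {b, c} = i"
      using i R2[of c b i a] R[of a d i] E comm by (metis rtranclp_trans)
    ultimately show ?thesis
      using ne by auto
  qed
  \<comment> \<open>Both diagonals are examined, since \<open>ab\<close> and \<open>cd\<close> leave
    open which of \<open>{b, c}\<close> and \<open>{d, a}\<close> carries which color.\<close>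
  obtain i where i: "\<not> (color_avoiding G \<Gamma> i)\<^sup>*\<^sup>* a c"
    using MD_coloring_separating_color[OF M V(1,3) dist(3)] .
  obtain j where j: "\<not> (color_avoiding G \<Gamma> j)\<^sup>*\<^sup>* b d"
    using MD_coloring_separating_color[OF M V(2,4) dist(4)] .
  have "(\<Gamma> {a, b} = i \<or> \<Gamma> {b, c} = i) \<and> (\<Gamma> {d, a} = i \<or> \<Gamma> {c, d} = i)"
    using i R2[of a b i c] R2[of a d i c] E comm by metis
  moreover have "(\<Gamma> {a, b} = j \<or> \<Gamma> {d, a} = j) \<and> (\<Gamma> {b, c} = j \<or> \<Gamma> {c, d} = j)"
    using j R2[of b a j d] R2[of b c j d] E comm by metis
  ultimately show False
    using ab cd ne by metis
qed

text \<open>The two edges span a 4-cycle in the product. Traversing it in its two directions from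
  \<open>(u, v)\<close> gives the two pairs of opposite sides.\<close>

lemma MD_coloring_cartesian_product_square:
  assumes G: "simple_graph G" and H: "simple_graph H"
    and M: "MD_coloring (G \<box> H) k \<Gamma>"
    and u: "{u, u'} \<in> edges G" and v: "{v, v'} \<in> edges H"
  shows "\<Gamma> ({u, u'} \<times> {v}) = \<Gamma> ({u, u'} \<times> {v'})"
    and "\<Gamma> ({u} \<times> {v, v'}) = \<Gamma> ({u'} \<times> {v, v'})"
proof -
  note V = simple_graph_edgeD[OF G u] simple_graph_edgeD[OF H v]
  have uv: "{u', u} \<in> edges G" "{v', v} \<in> edges H"
    using u v by (simp_all add: insert_commute)
  have "\<Gamma> {(u, v), (u', v)} = \<Gamma> {(u', v'), (u, v')}"
    using V u v uv
    by (intro MD_coloring_four_cycle[OF M]) (auto simp: doubleton_in_edges_cartesian_product)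
  then show "\<Gamma> ({u, u'} \<times> {v}) = \<Gamma> ({u, u'} \<times> {v'})"
    by (simp add: insert_commute)
  have "\<Gamma> {(u, v), (u, v')} = \<Gamma> {(u', v'), (u', v)}"
    using V u v uv
    by (intro MD_coloring_four_cycle[OF M]) (auto simp: doubleton_in_edges_cartesian_product)
  then show "\<Gamma> ({u} \<times> {v, v'}) = \<Gamma> ({u'} \<times> {v, v'})"
    by (simp add: insert_commute)
qed

section \<open>Upper bound: restriction to one copy of each factor\<close>

lemma connected_graph_constant:
  assumes "connected_graph G" "u \<in> verts G" "v \<in> verts G"
    and "\<And>x y. {x, y} \<in> edges G \<Longrightarrow> f x = f y"
  shows "f u = f v"
proof -
  have "(adj G)\<^sup>*\<^sup>* u v"
    using assms by (auto simp: connected_graph_def same_component_def)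
  then show ?thesis
    by induction (auto simp: adj_def dest: assms(4))
qed

text \<open>A walk in \<open>H\<close> that avoids a color is mapped by \<open>f\<close> to such a
  walk in \<open>G\<close>, so a color separating \<open>f x\<close> from \<open>f y\<close>
  separates \<open>x\<close> from \<open>y\<close>. Injectivity keeps distinct vertices
  distinct.\<close>

lemma MD_coloring_pullback:
  assumes M: "MD_coloring G k \<Gamma>" and "inj_on f (verts H)" and "f ` verts H \<subseteq> verts G"
    and E: "\<And>x y. {x, y} \<in> edges H \<Longrightarrow> {f x, f y} \<in> edges G"
    and H: "simple_graph H"
  shows "MD_coloring H k (\<lambda>e. \<Gamma> (f ` e))"
  unfolding MD_coloring_iff_color_avoiding
proof (intro conjI ballI impI)
  show "edge_coloring H k (\<lambda>e. \<Gamma> (f ` e))"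
    unfolding edge_coloring_def
  proof (intro image_subsetI)
    fix e assume e: "e \<in> edges H"
    then obtain x y where "e = {x, y}"
      using H by (auto elim: simple_graph_edgeE)
    then have "f ` e \<in> edges G"
      using E e by simp
    then show "\<Gamma> (f ` e) \<in> {1..k}"
      using M unfolding MD_coloring_def edge_coloring_def by blast
  qed
  fix x y assume "x \<in> verts H" "y \<in> verts H" "x \<noteq> y"
  then have "f x \<in> verts G" "f y \<in> verts G" "f x \<noteq> f y"
    using assms(2,3) by (auto simp: inj_on_def)
  then obtain i where i: "\<not> (color_avoiding G \<Gamma> i)\<^sup>*\<^sup>* (f x) (f y)"
    by (rule MD_coloring_separating_color[OF M])
  have "(color_avoiding G \<Gamma> i)\<^sup>*\<^sup>* (f x) (f y)" if "color_avoiding H (\<lambda>e. \<Gamma> (f ` e)) i x y" for x y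
    using that E by (auto simp: color_avoiding_def)
  with i show "\<exists>i. \<not> (color_avoiding H (\<lambda>e. \<Gamma> (f ` e)) i)\<^sup>*\<^sup>* x y"
    using rtranclp_map[of "color_avoiding H (\<lambda>e. \<Gamma> (f ` e)) i" x y "color_avoiding G \<Gamma> i" f]
    by blast
qed

lemma md_cartesian_product_le:
  assumes G: "simple_graph G" "connected_graph G" and H: "simple_graph H" "connected_graph H"
  shows "md (G \<box> H) \<le> md G + md H"
proof -
  obtain \<Gamma> k where M: "MD_coloring (G \<box> H) k \<Gamma>" and n: "num_colors (G \<box> H) \<Gamma> = md (G \<box> H)"
    using md_attained[OF simple_graph_cartesian_product[OF G(1) H(1)]] .
  obtain u0 v0 where u0: "u0 \<in> verts G" and v0: "v0 \<in> verts H"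
    using G H unfolding connected_graph_def by blast
  \<comment> \<open>The restrictions of \<open>\<Gamma>\<close> to the copy of \<open>G\<close> at
    \<open>v0\<close> and to the copy of \<open>H\<close> at \<open>u0\<close>.\<close>
  let ?g = "\<lambda>e. \<Gamma> ((\<lambda>u. (u, v0)) ` e)" and ?h = "\<lambda>f. \<Gamma> (Pair u0 ` f)"
  have g: "MD_coloring G k ?g"
    using u0 v0 G by (intro MD_coloring_pullback[OF M])
      (auto simp: inj_on_def doubleton_in_edges_cartesian_product dest: simple_graph_edgeD)
  have h: "MD_coloring H k ?h"
    using u0 v0 H by (intro MD_coloring_pullback[OF M])
      (auto simp: inj_on_def doubleton_in_edges_cartesian_product dest: simple_graph_edgeD)
  have cg: "\<Gamma> (e \<times> {v}) = ?g e" if e: "e \<in> edges G" and v: "v \<in> verts H" for e v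
  proof -
    obtain u u' where u: "e = {u, u'}"
      using e G by (auto elim: simple_graph_edgeE)
    \<comment> \<open>The color of the copy of \<open>e\<close> at \<open>v\<close> is a function of
      \<open>v\<close> that is unchanged across each edge of \<open>H\<close>, by the square spanned
      with \<open>e\<close>; hence it is constant on the connected graph \<open>H\<close>.\<close>
    have "\<Gamma> (e \<times> {v}) = \<Gamma> (e \<times> {v0})"
      using MD_coloring_cartesian_product_square(1)[OF G(1) H(1) M e[unfolded u]]
      unfolding u by (intro connected_graph_constant[OF H(2) v v0])
    moreover have "e \<times> {v0} = (\<lambda>u. (u, v0)) ` e"
      by auto
    ultimately show ?thesis
      by simp
  qed
  have ch: "\<Gamma> ({u} \<times> f) = ?h f" if f: "f \<in> edges H" and u: "u \<in> verts G" for f u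
  proof -
    obtain v v' where v: "f = {v, v'}"
      using f H by (auto elim: simple_graph_edgeE)
    have "\<Gamma> ({u} \<times> f) = \<Gamma> ({u0} \<times> f)"
      using MD_coloring_cartesian_product_square(2)[OF G(1) H(1) M _ f[unfolded v]]
      unfolding v by (intro connected_graph_constant[OF G(2) u u0])
    moreover have "{u0} \<times> f = Pair u0 ` f"
      by auto
    ultimately show ?thesis
      by simp
  qed
  have "\<Gamma> ` edges (G \<box> H) \<subseteq> ?g ` edges G \<union> ?h ` edges H"
  proof (intro image_subsetI)
    fix e assume "e \<in> edges (G \<box> H)"
    then show "\<Gamma> e \<in> ?g ` edges G \<union> ?h ` edges H"
      unfolding edges_cartesian_product[OF G(1) H(1)] using cg ch by blast
  qed
  then have "card (\<Gamma> ` edges (G \<box> H)) \<le> card (?g ` edges G \<union> ?h ` edges H)"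
    using G H by (intro card_mono) (simp_all add: finite_edges)
  \<comment> \<open>The two restrictions may share colors, so the union only gives an
    inequality.\<close>
  also have "\<dots> \<le> num_colors G ?g + num_colors H ?h"
    unfolding num_colors_def by (rule card_Un_le)
  also have "\<dots> \<le> md G + md H"
    by (intro add_mono num_colors_le_md[OF G(1) g] num_colors_le_md[OF H(1) h])
  finally show ?thesis
    unfolding n[symmetric] num_colors_def .
qed

theorem theorem4p1:
  fixes G :: "'a ugraph" and H :: "'b ugraph"
  assumes "simple_graph G" and "connected_graph G"
    and "simple_graph H" and "connected_graph H"
  shows "md (G \<box> H) = md G + md H"
proof (rule antisym)
  show "md (G \<box> H) \<le> md G + md H"
    by (rule md_cartesian_product_le[OF assms])
  show "md G + md H \<le> md (G \<box> H)"
    using assms by (intro md_cartesian_product_ge) (simp_all add: connected_graph_def)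
qed

end
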